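(* Let $\mathbb{F}$ be an algebraically closed field of characteristic zero, let $A$ be a finite-dimensional solvable Leibniz algebra over $\mathbb{F}$, and let $M$ be a finite-dimensional irreducible $A$-module. Then $\dim(M)=1$.
   Context: A (left) Leibniz algebra over $\mathbb{F}$ is an $\mathbb{F}$-vector space $A$ with a bilinear map $[\,,\,]:A\times A\to A$ satisfying $[a,[b,c]]=[[a,b],c]+[b,[a,c]]$ for all $a,b,c\in A$. The derived series is $A^{(1)}=[A,A]$, $A^{(i+1)}=[A^{(i)},A^{(i)}]$ (where $[X,Y]$ denotes the span of all products $[x,y]$, $x\in X$, $y\in Y$, and $A^{(0)}=A$); $A$ is solvable if $A^{(m)}=0$ for some integer $m\ge 0$. A module of $A$ is an $\mathbb{F}$-vector space $M$ with two bilinear maps $[\,,\,]:A\times M\to M$ and $[\,,\,]:M\times A\to M$ such that for all $a,b\in A$, $m\in M$: $[a,[b,m]]=[[a,b],m]+[b,[a,m]]$, $[a,[m,b]]=[[a,m],b]+[m,[a,b]]$, $[m,[a,b]]=[[m,a],b]+[a,[m,b]]$. A submodule is a subspace closed under both the left and the right action; $M$ is irreducible if $M\neq 0$ and its only submodules are $0$ and $M$. *)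

theory Defs
  imports Complex_Main "HOL-Computational_Algebra.Polynomial"
begin

definition bilinear_map ::
  "('f::field \<Rightarrow> 'a::ab_group_add \<Rightarrow> 'a) \<Rightarrow> ('f \<Rightarrow> 'b::ab_group_add \<Rightarrow> 'b) \<Rightarrow>
   ('f \<Rightarrow> 'c::ab_group_add \<Rightarrow> 'c) \<Rightarrow> ('a \<Rightarrow> 'b \<Rightarrow> 'c) \<Rightarrow> bool"
  where "bilinear_map s1 s2 s3 f \<longleftrightarrow>
    (\<forall>x. Vector_Spaces.linear s2 s3 (f x)) \<and>
    (\<forall>y. Vector_Spaces.linear s1 s3 (\<lambda>x. f x y))"

locale leibniz_algebra = vector_space scale
  for scale :: "'f::field \<Rightarrow> 'a::ab_group_add \<Rightarrow> 'a" +
  fixes br :: "'a \<Rightarrow> 'a \<Rightarrow> 'a"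
  assumes bilinear_br: "bilinear_map scale scale scale br"
    and leibniz: "br a (br b c) = br (br a b) c + br b (br a c)"
begin

definition product_space :: "'a set \<Rightarrow> 'a set \<Rightarrow> 'a set"
  where "product_space X Y = span {br x y | x y. x \<in> X \<and> y \<in> Y}"

primrec derived :: "nat \<Rightarrow> 'a set"
  where
    "derived 0 = UNIV"
  | "derived (Suc i) = product_space (derived i) (derived i)"

definition solvable :: bool
  where "solvable \<longleftrightarrow> (\<exists>m. derived m = {0})"

end

locale leibniz_module = leibniz_algebra scaleA br + M: vector_space scaleM
  for scaleA :: "'f::field \<Rightarrow> 'a::ab_group_add \<Rightarrow> 'a"
    and br :: "'a \<Rightarrow> 'a \<Rightarrow> 'a"
    and scaleM :: "'f \<Rightarrow> 'm::ab_group_add \<Rightarrow> 'm" +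
  fixes lact :: "'a \<Rightarrow> 'm \<Rightarrow> 'm"
    and ract :: "'m \<Rightarrow> 'a \<Rightarrow> 'm"
  assumes bilinear_lact: "bilinear_map scaleA scaleM scaleM lact"
    and bilinear_ract: "bilinear_map scaleM scaleA scaleM ract"
    and LLM: "lact a (lact b m) = lact (br a b) m + lact b (lact a m)"
    and LML: "lact a (ract m b) = ract (lact a m) b + ract m (br a b)"
    and MLL: "ract m (br a b) = ract (ract m a) b + lact a (ract m b)"
begin

definition submodule :: "'m set \<Rightarrow> bool"
  where "submodule N \<longleftrightarrow>
    M.subspace N \<and> (\<forall>a. \<forall>n\<in>N. lact a n \<in> N) \<and> (\<forall>a. \<forall>n\<in>N. ract n a \<in> N)"

definition irreducible_module :: bool
  where "irreducible_module \<longleftrightarrow>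
    (UNIV :: 'm set) \<noteq> {0} \<and> (\<forall>N. submodule N \<longrightarrow> N = {0} \<or> N = UNIV)"

end

end

theory Submission
  imports Defs
begin

text \<open>
  The module axioms give \<open>((m a) + (a m)) b = 0\<close>, so the common kernel of the right actions is a
  submodule; by irreducibility the right action is either zero or the negative of the left one. Hence
  submodules are the subspaces invariant under the left action, which is a representation \<open>T\<close>
  of \<open>A\<close> by commutators. As in Lie's theorem, descending induction on \<open>i\<close> shows that the
  \<open>i\<close>-th derived algebra acts by scalars. If the next one acts by scalars, the
  operators \<open>T x\<close> with \<open>x\<close> in the \<open>i\<close>-th one commute, since a commutator is a scalar that vanishes by the
  weight lemma below; they therefore have a common eigenvector, and its weight space is
  invariant, again by the weight lemma.
\<close>

section \<open>Linear maps and polynomials in an operator\<close>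

lemma linear_simps:
  assumes "Vector_Spaces.linear s1 s2 f"
  shows "f (x + y) = f x + f y" "f (s1 c x) = s2 c (f x)" "f 0 = 0"
    "f (x - y) = f x - f y"
proof -
  interpret Vector_Spaces.linear s1 s2 f by fact
  show "f (x + y) = f x + f y" "f (s1 c x) = s2 c (f x)" "f 0 = 0"
    "f (x - y) = f x - f y"
    by (simp_all add: add scale zero diff)
qed

text \<open>This is \<open>p(f) v\<close>, evaluated by Horner's rule at a single vector instead of
  in the algebra of endomorphisms.\<close>

definition poly_action ::
  "('f::zero \<Rightarrow> 'v::ab_group_add \<Rightarrow> 'v) \<Rightarrow> ('v \<Rightarrow> 'v) \<Rightarrow> 'f poly \<Rightarrow> 'v \<Rightarrow> 'v"
  where "poly_action s f p v = fold_coeffs (\<lambda>a w. s a v + f w) p 0"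

context vector_space
begin

text \<open>Letting \<open>S\<close> and \<open>U\<close> differ covers operators that raise or
  lower a flag of spans by one step.\<close>

lemma linear_span_invariant:
  assumes f: "Vector_Spaces.linear scale scale f"
    and S: "\<And>x. x \<in> S \<Longrightarrow> f x \<in> span U" and x: "x \<in> span S"
  shows "f x \<in> span U"
  using x
proof (induction rule: span_induct)
  case base
  show ?case
    by (auto simp: subspace_def linear_simps[OF f] span_zero span_add span_scale)
next
  case (step x)
  then show ?case by (rule S)
qed

lemma subspace_eigenspace:
  assumes f: "Vector_Spaces.linear scale scale f"
  shows "subspace {x. f x = c *s x}"
  by (auto simp: subspace_def linear_simps[OF f] scale_right_distrib scale_left_commute)

lemma poly_action_0 [simp]: "poly_action scale f 0 v = 0"
  by (simp add: poly_action_def)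

lemma poly_action_pCons:
  assumes "Vector_Spaces.linear scale scale f"
  shows "poly_action scale f (pCons a p) v = a *s v + f (poly_action scale f p v)"
  by (cases "a = 0 \<and> p = 0") (auto simp: poly_action_def linear_simps[OF assms])

lemma poly_action_add:
  assumes "Vector_Spaces.linear scale scale f"
  shows "poly_action scale f (p + q) v = poly_action scale f p v + poly_action scale f q v"
  by (induction p q rule: poly_induct2)
    (simp_all add: poly_action_pCons[OF assms] linear_simps[OF assms] scale_left_distrib)

lemma poly_action_smult:
  assumes "Vector_Spaces.linear scale scale f"
  shows "poly_action scale f (smult c p) v = c *s poly_action scale f p v"
  by (induction p)
    (simp_all add: poly_action_pCons[OF assms] linear_simps[OF assms] scale_right_distrib)

lemma poly_action_monom:
  assumes "Vector_Spaces.linear scale scale f"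
  shows "poly_action scale f (monom c n) v = c *s (f ^^ n) v"
  by (induction n) (simp_all add: poly_action_pCons[OF assms] linear_simps[OF assms] monom_0 monom_Suc)

lemma poly_action_in_subspace:
  assumes "Vector_Spaces.linear scale scale f" "subspace W" "f ` W \<subseteq> W" "v \<in> W"
  shows "poly_action scale f p v \<in> W"
  by (induction p)
    (use assms in \<open>auto simp: poly_action_pCons subspace_0 image_subset_iff intro!: subspace_add subspace_scale\<close>)

text \<open>The bound on the coefficients later keeps the difference with the \<open>n\<close>-th
  monomial nonzero.\<close>

lemma span_powers_poly_action:
  assumes f: "Vector_Spaces.linear scale scale f"
    and "x \<in> span ((\<lambda>k. (f ^^ k) v) ` {..<n})"
  shows "\<exists>p. (\<forall>k\<ge>n. coeff p k = 0) \<and> poly_action scale f p v = x"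
  using assms(2)
proof (induction n arbitrary: x)
  case 0
  then show ?case by (auto intro!: exI[of _ 0])
next
  case (Suc n)
  then obtain c where "x - c *s (f ^^ n) v \<in> span ((\<lambda>k. (f ^^ k) v) ` {..<n})"
    by (auto simp: lessThan_Suc span_breakdown_eq)
  from Suc.IH[OF this] obtain p where "\<forall>k\<ge>n. coeff p k = 0" "poly_action scale f p v = x - c *s (f ^^ n) v"
    by blast
  then show ?case
    by (intro exI[of _ "p + monom c n"]) (auto simp: poly_action_add[OF f] poly_action_monom[OF f])
qed

end

section \<open>Eigenvectors in finite dimension\<close>

context finite_dimensional_vector_space
begin

text \<open>Otherwise every initial segment would be independent with distinct entries, and a long
  one would exceed the dimension.\<close>

lemma sequence_in_span_of_previous:
  fixes g :: "nat \<Rightarrow> 'b"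
  shows "\<exists>n. g n \<in> span (g ` {..<n})"
proof (rule ccontr)
  assume *: "\<not> ?thesis"
  have indep: "independent (g ` {..<n}) \<and> card (g ` {..<n}) = n" for n
  proof (induction n)
    case 0
    show ?case by (simp add: independent_empty)
  next
    case (Suc n)
    have notin: "g n \<notin> span (g ` {..<n})"
      using * by simp
    then have "g n \<notin> g ` {..<n}"
      by (rule contra_subsetD[OF span_superset])
    with notin Suc show ?case
      by (simp add: lessThan_Suc independent_insertI)
  qed
  have "card (g ` {..<Suc dimension}) \<le> dim (UNIV :: 'b set)"
    by (rule independent_card_le_dim[OF subset_UNIV conjunct1[OF indep]])
  then have "Suc dimension \<le> dim (UNIV :: 'b set)"
    unfolding conjunct2[OF indep] .
  then show False
    using dim_subset_UNIV[of UNIV] by linarith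
qed

lemma annihilating_poly_exists:
  assumes f: "Vector_Spaces.linear scale scale f"
  shows "\<exists>p. p \<noteq> 0 \<and> poly_action scale f p v = 0"
proof -
  obtain n where "(f ^^ n) v \<in> span ((\<lambda>k. (f ^^ k) v) ` {..<n})"
    using sequence_in_span_of_previous[of "\<lambda>k. (f ^^ k) v"] by blast
  from span_powers_poly_action[OF f this] obtain p
    where p: "\<forall>k\<ge>n. coeff p k = 0" "poly_action scale f p v = (f ^^ n) v"
    by blast
  have "coeff (p + monom (- 1) n) n \<noteq> 0"
    using p by simp
  moreover have "poly_action scale f (p + monom (- 1) n) v = 0"
    using p by (simp add: poly_action_add[OF f] poly_action_monom[OF f])
  ultimately show ?thesis
    by (metis coeff_0)
qed

end

text \<open>Let \<open>p\<close> of least degree annihilate a nonzero \<open>v\<close> in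
  \<open>W\<close>, and write \<open>p = (X - c) q\<close> for a root \<open>c\<close>. By
  minimality \<open>q(f) v\<close> is nonzero; it lies in \<open>W\<close> and is an eigenvector for
  \<open>c\<close>.\<close>

lemma eigenvector_exists:
  fixes scale :: "'f::alg_closed_field \<Rightarrow> 'v::ab_group_add \<Rightarrow> 'v" (infixr "*s" 75)
  assumes "finite_dimensional_vector_space scale B"
    and f: "Vector_Spaces.linear scale scale f"
    and W: "module.subspace scale W" "f ` W \<subseteq> W" "W \<noteq> {0}"
  shows "\<exists>c. \<exists>v\<in>W. v \<noteq> 0 \<and> f v = scale c v"
proof -
  interpret finite_dimensional_vector_space scale B by fact
  obtain v where v: "v \<in> W" "v \<noteq> 0"
    using W subspace_0 by blast
  obtain p where p: "p \<noteq> 0" "poly_action scale f p v = 0"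
    and least: "\<And>q. q \<noteq> 0 \<Longrightarrow> poly_action scale f q v = 0 \<Longrightarrow> degree p \<le> degree q"
    using ex_has_least_nat[of "\<lambda>p. p \<noteq> 0 \<and> poly_action scale f p v = 0" _ degree]
      annihilating_poly_exists[OF f] by metis
  have deg: "degree p \<noteq> 0"
  proof
    assume "degree p = 0"
    then obtain a where "p = [:a:]"
      by (rule degree_eq_zeroE)
    with p v show False
      by (simp add: poly_action_pCons[OF f] linear_simps[OF f])
  qed
  then obtain c where c: "poly p c = 0"
    using alg_closed_imp_poly_has_root by blast
  define q where "q = synthetic_div p c"
  have "q \<noteq> 0" "degree q < degree p"
    using deg by (auto simp: q_def synthetic_div_eq_0_iff degree_synthetic_div)
  then have q: "poly_action scale f q v \<noteq> 0"
    using least by (meson leD)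
  have "p + smult c q = pCons 0 q"
    using synthetic_div_correct[of p c] c by (simp add: q_def)
  then have "poly_action scale f (p + smult c q) v = poly_action scale f (pCons 0 q) v"
    by simp
  then have "f (poly_action scale f q v) = c *s poly_action scale f q v"
    using p by (simp add: poly_action_add[OF f] poly_action_smult[OF f] poly_action_pCons[OF f])
  with q poly_action_in_subspace[OF f W(1,2) v(1)] show ?thesis
    by blast
qed

text \<open>In a nonzero \<open>F\<close>-invariant subspace \<open>W\<close> of least dimension, an
  eigenspace of any \<open>f\<close> is again invariant because the operators commute, so it is all
  of \<open>W\<close>. Minimizing the dimension also handles infinite \<open>F\<close>.\<close>

lemma commuting_common_eigenvector:
  fixes scale :: "'f::alg_closed_field \<Rightarrow> 'v::ab_group_add \<Rightarrow> 'v" (infixr "*s" 75)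
  assumes "finite_dimensional_vector_space scale B" and nz: "(UNIV :: 'v set) \<noteq> {0}"
    and lin: "\<And>f. f \<in> F \<Longrightarrow> Vector_Spaces.linear scale scale f"
    and comm: "\<And>f g x. f \<in> F \<Longrightarrow> g \<in> F \<Longrightarrow> f (g x) = g (f x)"
  shows "\<exists>v. v \<noteq> 0 \<and> (\<forall>f\<in>F. \<exists>c. f v = scale c v)"
proof -
  interpret finite_dimensional_vector_space scale B by fact
  define P where "P W \<longleftrightarrow> subspace W \<and> W \<noteq> {0} \<and> (\<forall>f\<in>F. f ` W \<subseteq> W)" for W
  have "P UNIV"
    using nz by (auto simp: P_def)
  then obtain W where W: "P W" and least: "\<And>V. P V \<Longrightarrow> dim W \<le> dim V"
    using ex_has_least_nat[of P UNIV dim] by blast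
  have scalar: "\<exists>c. \<forall>w\<in>W. f w = c *s w" if f: "f \<in> F" for f
  proof -
    obtain c v where v: "v \<in> W" "v \<noteq> 0" "f v = c *s v"
      using eigenvector_exists[OF assms(1) lin[OF f], of W] W f unfolding P_def by blast
    define V where "V = W \<inter> {x. f x = c *s x}"
    have "P V"
      unfolding P_def
    proof (intro conjI ballI)
      show "subspace V"
        unfolding V_def using W by (intro subspace_inter subspace_eigenspace lin f) (simp add: P_def)
      show "V \<noteq> {0}"
        using v by (auto simp: V_def)
      fix g assume g: "g \<in> F"
      then show "g ` V \<subseteq> V"
        using W f by (auto simp: V_def P_def comm[of f g] linear_simps[OF lin[OF g]])
    qed
    moreover have "V \<subseteq> W"
      by (simp add: V_def)
    ultimately have "V = W"
      using subspace_dim_equal[of V W] least[of V] W by (auto simp: P_def)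
    then show ?thesis
      by (auto simp: V_def)
  qed
  obtain v where "v \<in> W" "v \<noteq> 0"
    using W subspace_0 by (auto simp: P_def)
  with scalar show ?thesis
    by blast
qed

section \<open>Weights of commutators\<close>

text \<open>
  On the span of \<open>v, T v, T\<^sup>2 v, \<dots>\<close> each \<open>X \<in> F\<close> is triangular with a single eigenvalue, and the
  superdiagonal entries of \<open>X\<close> are the multiples \<open>- k \<mu>\<close>, where \<open>Y v = \<mu> v\<close>. The first
  linear dependence among the \<open>T\<^sup>k v\<close> then forces \<open>\<mu> = 0\<close> in characteristic zero.
\<close>

lemma weight_of_commutator_eq_0:
  fixes scale :: "'f::field_char_0 \<Rightarrow> 'v::ab_group_add \<Rightarrow> 'v" (infixr "*s" 75)
  assumes "finite_dimensional_vector_space scale B"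
    and T: "Vector_Spaces.linear scale scale T"
    and lin: "\<And>X. X \<in> F \<Longrightarrow> Vector_Spaces.linear scale scale X"
    and comm: "\<And>X. X \<in> F \<Longrightarrow> \<exists>Y\<in>F. \<forall>m. T (X m) = X (T m) + Y m"
    and weight: "\<And>X. X \<in> F \<Longrightarrow> \<exists>c. X v = scale c v" and v: "v \<noteq> 0"
    and X: "X \<in> F" and Y: "Y \<in> F" "\<And>m. T (X m) = X (T m) + Y m"
  shows "Y v = 0"
proof -
  interpret finite_dimensional_vector_space scale B by fact
  note T_simps = linear_simps[OF T]
  obtain lam where lam: "\<And>X. X \<in> F \<Longrightarrow> X v = lam X *s v"
    using weight by metis
  define g where "g k = (T ^^ k) v" for k
  \<comment> \<open>\<open>W k\<close> stops before \<open>g k\<close>: thus \<open>W 0\<close> is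
    zero, and \<open>g n \<in> W n\<close> means that \<open>g n\<close> depends on its
    predecessors.\<close>
  define W where "W k = span (g ` {..<k})" for k
  have g_Suc: "g (Suc k) = T (g k)" for k
    by (simp add: g_def)
  have W_mono: "W j \<subseteq> W k" if "j \<le> k" for j k
    unfolding W_def using that by (intro span_mono) auto
  have g_in: "g j \<in> W k" if "j < k" for j k
    unfolding W_def using that by (auto intro: span_base)
  have T_W: "T x \<in> W (Suc k)" if "x \<in> W k" for x k
    using that unfolding W_def
    by (rule linear_span_invariant[OF T, rotated]) (auto simp: g_Suc[symmetric] intro: span_base)
  have W_add: "x + y \<in> W k" and W_diff: "x - y \<in> W k" if "x \<in> W k" "y \<in> W k" for x y k
    using that by (simp_all add: W_def span_add span_diff)
  have W_scale: "c *s x \<in> W k" if "x \<in> W k" for x c k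
    using that by (simp add: W_def span_scale)
  \<comment> \<open>The operator stays general in the induction: moving it past \<open>T\<close>
    leaves a commutator \<open>Z\<close>, another member of \<open>F\<close>.\<close>
  have tri: "X (g k) - lam X *s g k \<in> W k" if "X \<in> F" for X k
    using that
  proof (induction k arbitrary: X)
    case 0
    then show ?case by (simp add: g_def lam W_def span_zero)
  next
    case (Suc k)
    obtain Z where Z: "Z \<in> F" "\<And>m. T (X m) = X (T m) + Z m"
      using comm[OF Suc.prems] by blast
    let ?w = "X (g k) - lam X *s g k" and ?w' = "Z (g k) - lam Z *s g k"
    have "X (g (Suc k)) - lam X *s g (Suc k) = T ?w - (?w' + lam Z *s g k)"
      using Z(2)[of "g k"] by (simp add: g_Suc T_simps algebra_simps)
    moreover have "T ?w \<in> W (Suc k)"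
      by (rule T_W[OF Suc.IH[OF Suc.prems]])
    moreover have "?w' + lam Z *s g k \<in> W (Suc k)"
      using Suc.IH[OF Z(1)] W_mono[of k "Suc k"] g_in[of k "Suc k"] by (intro W_add W_scale) auto
    ultimately show ?case
      by (metis W_diff)
  qed
  let ?mu = "lam Y"
  \<comment> \<open>Each passage of \<open>X\<close> across one factor \<open>T\<close> leaves
    \<open>- Y\<close>, with diagonal entry \<open>- ?mu\<close>; in \<open>g (Suc k)\<close> there
    are \<open>Suc k\<close> factors to cross.\<close>
  have superdiag: "X (g (Suc k)) - lam X *s g (Suc k) + (of_nat (Suc k) * ?mu) *s g k \<in> W k" for k
  proof (induction k)
    case 0
    show ?case
      using Y(2)[of v] lam[OF X] lam[OF Y(1)] by (simp add: g_def T_simps W_def span_zero)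
  next
    case (Suc k)
    let ?w = "X (g (Suc k)) - lam X *s g (Suc k) + (of_nat (Suc k) * ?mu) *s g k"
    let ?w' = "Y (g (Suc k)) - ?mu *s g (Suc k)"
    have coeff_Suc: "(of_nat (Suc (Suc k)) * ?mu) *s x = (of_nat (Suc k) * ?mu) *s x + ?mu *s x" for x
      by (subst of_nat_Suc) (simp add: distrib_right scale_left_distrib add.commute del: of_nat_Suc)
    have "X (g (Suc (Suc k))) - lam X *s g (Suc (Suc k))
        + (of_nat (Suc (Suc k)) * ?mu) *s g (Suc k) = T ?w - ?w'"
      using Y(2)[of "g (Suc k)"] coeff_Suc
      by (simp add: g_Suc[of "Suc k"] g_Suc[of k, symmetric] T_simps del: of_nat_Suc)
    moreover have "T ?w \<in> W (Suc k)"
      by (rule T_W[OF Suc.IH])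
    ultimately show ?case
      using tri[OF Y(1), of "Suc k"] by (metis W_diff)
  qed
  have shift: "X x - lam X *s x \<in> W k" if "x \<in> W (Suc k)" for x k
  proof -
    have D: "Vector_Spaces.linear scale scale (\<lambda>x. X x - lam X *s x)"
      unfolding Vector_Spaces.linear_iff
      by (auto simp: linear_simps[OF lin[OF X]] algebra_simps vector_space_axioms mult.commute)
    show ?thesis
      using that unfolding W_def
    proof (rule linear_span_invariant[OF D, rotated])
      fix y assume "y \<in> g ` {..<Suc k}"
      then obtain j where j: "j \<le> k" "y = g j"
        by (metis imageE lessThan_iff less_Suc_eq_le)
      show "X y - lam X *s y \<in> span (g ` {..<k})"
        using tri[OF X, of j] W_mono[OF j(1)] unfolding W_def j(2) by blast
    qed
  qed
  obtain n where n: "g n \<in> W n" and least: "\<And>m. g m \<in> W m \<Longrightarrow> n \<le> m"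
    using sequence_in_span_of_previous[of g] exists_least_iff[of "\<lambda>n. g n \<in> W n"]
    unfolding W_def by (metis not_less)
  have "n \<noteq> 0"
    by (rule notI) (use n v in \<open>simp add: g_def W_def\<close>)
  then obtain k where k: "n = Suc k"
    using not0_implies_Suc by blast
  define c where "c = of_nat (Suc k) * ?mu"
  \<comment> \<open>As \<open>g n\<close> lies in \<open>W n\<close>, \<open>shift\<close> already
    puts \<open>X (g n) - lam X *s g n\<close> into \<open>W k\<close>; comparison with
    \<open>superdiag\<close> isolates the superdiagonal term.\<close>
  have "c *s g k \<in> W k"
    using W_diff[OF superdiag[of k] shift[OF n[unfolded k]]] unfolding c_def[symmetric] k
    by (simp only: add_diff_cancel_left')
  then have "inverse c *s (c *s g k) \<in> W k"
    by (rule W_scale)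
  moreover have "g k \<notin> W k"
    using least[of k] k by auto
  ultimately have "c = 0"
    by (cases "c = 0") simp_all
  \<comment> \<open>Characteristic zero enters here: \<open>of_nat (Suc k)\<close> is
    nonzero.\<close>
  then have "?mu = 0"
    unfolding c_def mult_eq_0_iff of_nat_eq_0_iff by simp
  then show ?thesis
    by (simp add: lam[OF Y(1)])
qed

section \<open>Derived series and irreducible modules\<close>

context leibniz_algebra
begin

lemma linear_br_left: "Vector_Spaces.linear scale scale (br a)"
  using bilinear_br by (simp add: bilinear_map_def)

lemma subspace_derived: "subspace (derived i)"
  by (cases i) (simp_all add: product_space_def)

lemma br_in_derived_Suc: "x \<in> derived i \<Longrightarrow> y \<in> derived i \<Longrightarrow> br x y \<in> derived (Suc i)"
  by (auto simp: product_space_def intro: span_base)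

text \<open>By the Leibniz identity left multiplication by \<open>a\<close> is a derivation, so it
  carries a product of two elements of \<open>derived i\<close> to a sum of two such
  products.\<close>

lemma derived_left_ideal: "x \<in> derived i \<Longrightarrow> br a x \<in> derived i"
proof (induction i arbitrary: x)
  case (Suc i)
  show ?case
    using Suc.prems unfolding derived.simps product_space_def
  proof (rule linear_span_invariant[OF linear_br_left, rotated])
    fix z assume "z \<in> {br x y | x y. x \<in> derived i \<and> y \<in> derived i}"
    then obtain x y where "x \<in> derived i" "y \<in> derived i" "z = br x y"
      by blast
    then have "br a z \<in> derived (Suc i)"
      using Suc.IH br_in_derived_Suc subspace_derived[of "Suc i"]
      by (subst \<open>z = br x y\<close>, subst leibniz) (blast intro: subspace_add)
    then show "br a z \<in> span {br x y | x y. x \<in> derived i \<and> y \<in> derived i}"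
      by (simp add: product_space_def)
  qed
qed simp

end

context leibniz_module
begin

lemma linear_lact: "Vector_Spaces.linear scaleM scaleM (lact a)"
  using bilinear_lact by (simp add: bilinear_map_def)

lemma linear_ract: "Vector_Spaces.linear scaleM scaleM (\<lambda>m. ract m a)"
  using bilinear_ract by (simp add: bilinear_map_def)

lemma linear_lact_algebra: "Vector_Spaces.linear scaleA scaleM (\<lambda>a. lact a m)"
  using bilinear_lact by (simp add: bilinear_map_def)

text \<open>Adding \<open>LML\<close> and \<open>MLL\<close> cancels \<open>ract m (br a b)\<close>
  and \<open>lact a (ract m b)\<close>.\<close>

lemma ract_ract_add_lact: "ract (ract m a + lact a m) b = 0"
  using LML[of a m b] MLL[of m a b] by (simp add: linear_simps[OF linear_ract] algebra_simps)

lemma irreducible_ract_cases: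
  assumes "irreducible_module"
  shows "(\<forall>m a. ract m a = 0) \<or> (\<forall>m a. ract m a = - lact a m)"
proof -
  let ?K = "{m. \<forall>a. ract m a = 0}"
  have "submodule ?K"
    unfolding submodule_def
  proof (intro conjI allI ballI)
    show "M.subspace ?K"
      by (auto simp: M.subspace_def linear_simps[OF linear_ract])
    \<comment> \<open>For a vector of \<open>?K\<close> two of the three terms of \<open>LML\<close>
      vanish, hence also the third.\<close>
    show "lact a n \<in> ?K" if "n \<in> ?K" for a n
      using that LML[of a n] by (simp add: linear_simps[OF linear_lact])
    show "ract n a \<in> ?K" if "n \<in> ?K" for a n
      using that by (simp add: linear_simps[OF linear_ract])
  qed
  then consider "?K = {0}" | "?K = UNIV"
    using assms by (auto simp: irreducible_module_def)
  then show ?thesis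
  proof cases
    case 1
    then have "ract m a + lact a m = 0" for m a
      using ract_ract_add_lact[of m a] by blast
    then show ?thesis
      by (simp add: add_eq_0_iff2)
  next
    case 2
    then show ?thesis by blast
  qed
qed

text \<open>In both cases of \<open>irreducible_ract_cases\<close> a subspace stable under the left
  action is stable under the right one, so from here on only \<open>lact\<close> matters.\<close>

lemma irreducible_lact_invariant:
  assumes "irreducible_module" "M.subspace N" "\<And>a n. n \<in> N \<Longrightarrow> lact a n \<in> N"
  shows "N = {0} \<or> N = UNIV"
proof -
  have "submodule N"
    using assms irreducible_ract_cases[OF assms(1)]
    by (auto simp: submodule_def M.subspace_0 M.subspace_neg)
  then show ?thesis
    using assms(1) by (simp add: irreducible_module_def)
qed

end

section \<open>Descent along the derived series\<close>

theorem theorem3p2: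
  fixes scaleA :: "'f::{alg_closed_field, field_char_0} \<Rightarrow> 'a::ab_group_add \<Rightarrow> 'a"
    and br :: "'a \<Rightarrow> 'a \<Rightarrow> 'a"
    and scaleM :: "'f \<Rightarrow> 'm::ab_group_add \<Rightarrow> 'm"
    and lact :: "'a \<Rightarrow> 'm \<Rightarrow> 'm"
    and ract :: "'m \<Rightarrow> 'a \<Rightarrow> 'm"
  assumes "leibniz_algebra scaleA br"
    and "\<exists>B. finite_dimensional_vector_space scaleA B"
    and "leibniz_algebra.solvable scaleA br"
    and "leibniz_module scaleA br scaleM lact ract"
    and "\<exists>B. finite_dimensional_vector_space scaleM B"
    and "leibniz_module.irreducible_module scaleM lact ract"
  shows "vector_space.dim scaleM UNIV = 1"
proof -
  interpret leibniz_module scaleA br scaleM lact ract by fact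
  obtain B where B: "finite_dimensional_vector_space scaleM B"
    using assms by blast
  interpret MF: finite_dimensional_vector_space scaleM B by fact
  have nz: "(UNIV :: 'm set) \<noteq> {0}"
    using assms(6) by (simp add: irreducible_module_def)
  obtain v0 :: 'm where v0: "v0 \<noteq> 0"
    using nz by blast
  obtain m where m: "derived m = {0}"
    using assms(3) by (auto simp: solvable_def)
  let ?scalar = "\<lambda>i. \<forall>x\<in>derived i. \<exists>c. \<forall>u. lact x u = scaleM c u"
  have descend: "?scalar i" if IH: "?scalar (Suc i)" for i
  proof -
    \<comment> \<open>By \<open>IH\<close> the bracket acts by a scalar, so it is enough that it
      kills one nonzero vector; an eigenvector of \<open>lact y\<close> serves.\<close>
    have comm: "lact (br x y) u = 0" if x: "x \<in> derived i" and y: "y \<in> derived i" for x y u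
    proof -
      have xy: "br x y \<in> derived (Suc i)"
        using x y by (rule br_in_derived_Suc)
      obtain c v where v: "v \<noteq> 0" "lact y v = scaleM c v"
        using eigenvector_exists[OF B linear_lact, of UNIV y] nz by auto
      have "lact (br x y) v = 0"
      \<comment> \<open>\<open>y\<close> may lie outside \<open>derived (Suc i)\<close>, so it is
        added by hand. Commutators with \<open>lact x\<close> stay in the family: \<open>y\<close>
        gives \<open>br x y\<close>, and the rest remain in the left ideal
        \<open>derived (Suc i)\<close>.\<close>
      proof (rule weight_of_commutator_eq_0[OF B, where T = "lact x" and X = "lact y" and v = v
            and F = "lact ` insert y (derived (Suc i))"])
        show "\<exists>Y\<in>lact ` insert y (derived (Suc i)). \<forall>m. lact x (X m) = X (lact x m) + Y m"
          if "X \<in> lact ` insert y (derived (Suc i))" for X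
        proof -
          from that obtain z where z: "z \<in> insert y (derived (Suc i))" "X = lact z"
            by blast
          then have "br x z \<in> derived (Suc i)"
            using xy derived_left_ideal by blast
          then show ?thesis
            using z LLM[of x z] by (intro bexI[of _ "lact (br x z)"]) (auto simp: add.commute)
        qed
        show "lact x (lact y m) = lact y (lact x m) + lact (br x y) m" for m
          using LLM[of x y m] by (simp add: add.commute)
      qed (use v IH xy in \<open>auto simp: linear_lact\<close>)
      then show ?thesis
        using IH xy v(1) by (metis M.scale_eq_0_iff M.scale_zero_left)
    qed
    have "\<exists>v. v \<noteq> 0 \<and> (\<forall>f\<in>lact ` derived i. \<exists>c. f v = scaleM c v)"
    proof (rule commuting_common_eigenvector[OF B nz])
      fix f g u assume "f \<in> lact ` derived i" "g \<in> lact ` derived i"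
      then obtain x y where "x \<in> derived i" "y \<in> derived i" "f = lact x" "g = lact y"
        by blast
      then show "f (g u) = g (f u)"
        using LLM[of x y u] comm[of x y u] by simp
    qed (auto simp: linear_lact)
    then obtain v where v: "v \<noteq> 0" "\<forall>f\<in>lact ` derived i. \<exists>c. f v = scaleM c v"
      by blast
    then obtain lam where lam: "\<And>x. x \<in> derived i \<Longrightarrow> lact x v = scaleM (lam x) v"
      unfolding ball_simps by metis
    define V where "V = {u. \<forall>x\<in>derived i. lact x u = scaleM (lam x) u}"
    \<comment> \<open>Unlike in \<open>comm\<close>, \<open>a\<close> ranges over the whole algebra;
      the left ideal \<open>derived i\<close> itself supplies \<open>F\<close>.\<close>
    have weight: "lam (br a x) = 0" if x: "x \<in> derived i" for a x
    proof -
      have ax: "br a x \<in> derived i"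
        using x by (rule derived_left_ideal)
      have "lact (br a x) v = 0"
      proof (rule weight_of_commutator_eq_0[OF B, where T = "lact a" and X = "lact x" and v = v
            and F = "lact ` derived i"])
        show "\<exists>Y\<in>lact ` derived i. \<forall>m. lact a (X m) = X (lact a m) + Y m"
          if "X \<in> lact ` derived i" for X
        proof -
          from that obtain z where z: "z \<in> derived i" "X = lact z"
            by blast
          then show ?thesis
            using LLM[of a z] derived_left_ideal[of z i a]
            by (intro bexI[of _ "lact (br a z)"]) (auto simp: add.commute)
        qed
        show "lact a (lact x m) = lact x (lact a m) + lact (br a x) m" for m
          using LLM[of a x m] by (simp add: add.commute)
      qed (use v x ax in \<open>auto simp: linear_lact\<close>)
      then show ?thesis
        using lam[OF ax] v(1) by simp
    qed
    have "V = {0} \<or> V = UNIV"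
    proof (rule irreducible_lact_invariant[OF assms(6)])
      show "M.subspace V"
        by (auto simp: V_def M.subspace_def linear_simps[OF linear_lact] M.scale_right_distrib
            M.scale_left_commute)
      fix a u assume u: "u \<in> V"
      have "lact x (lact a u) = scaleM (lam x) (lact a u)" if x: "x \<in> derived i" for x
      proof -
        \<comment> \<open>The commutator of \<open>lact a\<close> and \<open>lact x\<close> acts on
          \<open>u\<close> by \<open>lam (br a x)\<close>, which is zero.\<close>
        have "lact (br a x) u = 0"
          using u derived_left_ideal[OF x, of a] weight[OF x, of a] by (simp add: V_def)
        then show ?thesis
          using LLM[of a x u] u x by (simp add: V_def linear_simps[OF linear_lact])
      qed
      then show "lact a u \<in> V"
        by (simp add: V_def)
    qed
    moreover have "v \<in> V"
      using lam by (simp add: V_def)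
    ultimately have "V = UNIV"
      using v(1) by blast
    then show ?thesis
      unfolding V_def by blast
  qed
  have "?scalar m"
    by (auto simp: m linear_simps[OF linear_lact_algebra] intro!: exI[of _ 0])
  \<comment> \<open>The induction runs downward from \<open>m\<close>, where the derived algebra is
    zero, to \<open>derived 0\<close>, the whole algebra.\<close>
  then have "?scalar 0"
    by (rule inc_induct[OF le0]) (rule descend)
  then have scalar: "\<exists>c. \<forall>u. lact a u = scaleM c u" for a
    by simp
  \<comment> \<open>Since every \<open>a\<close> acts by a scalar, the line through
    \<open>v0\<close> is invariant.\<close>
  have "M.span {v0} = {0} \<or> M.span {v0} = UNIV"
  proof (rule irreducible_lact_invariant[OF assms(6)])
    show "lact a u \<in> M.span {v0}" if "u \<in> M.span {v0}" for a u
      using scalar[of a] that by (auto intro: M.span_scale)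
  qed simp
  then have "M.span {v0} = UNIV"
    using v0 M.span_base[of v0 "{v0}"] by auto
  then have "M.dim (UNIV :: 'm set) = M.dim {v0}"
    by (metis M.dim_span)
  then show ?thesis
    using v0 by simp
qed

end
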